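(* Let $\sigma,\rho,\beta>0$, let $K=\frac{\beta^2(\rho+\sigma)^2}{4(\beta-1)}$, and let $(x,y,z)$ be a solution of the Lorenz 63 system lying on its global attractor, so that $x(t)^2+y(t)^2+z(t)^2\le K$ for all $t\in\mathbb{R}$. Let $\delta>0$ and let $0=t_0<t_1<t_2<\cdots$ be observation times with $t_{n+1}-t_n=\delta$. Let $(\bar x,\bar y,\bar z)$ be a continuous solution on $[0,\infty)$ of the nudged system with discrete-in-time $x$-component observations and parameter $\mu>0$: for every $n\ge 0$ and $t\in[t_n,t_{n+1})$, $$\frac{d\bar x}{dt}=\sigma(\bar y-\bar x)-\mu\big(\bar x(t_n)-x(t_n)\big),\qquad \frac{d\bar y}{dt}=\bar x(\rho-\bar z)-\bar y,\qquad \frac{d\bar z}{dt}=\bar x\bar y-\beta\bar z .$$ Put $V=(x-\bar x)^2+(y-\bar y)^2+(z-\bar z)^2$. Suppose $$\mu\ge 2(\rho+\sigma)^2-2\sigma+2K+\frac{K}{\beta}\qquad\text{and}\qquad \delta\le\min\Big\{\frac{1}{2\mu},\ \frac{1}{64(\sigma+\mu)^2},\ \frac{1}{32\mu\sigma^2}\Big\}.$$ Let $c=\min\{\frac{\mu}{2},1,\beta\}$ and $\gamma=\frac{1}{2c}\big(1+(2c-1)e^{-c\delta}\big)$. Then $\gamma<1$ and, for every $n\ge0$, $$V(t)\le\gamma^n V(0)\quad\text{for all } t\in[t_n,t_{n+1}).$$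
   Context: The Lorenz 63 system with parameters $\sigma,\rho,\beta>0$ is $$\frac{dx}{dt}=\sigma(y-x),\qquad \frac{dy}{dt}=x(\rho-z)-y,\qquad \frac{dz}{dt}=xy-\beta z .$$ Standing assumption: the reference solution $(x,y,z)$ lies on the global attractor of this system, and one has at one's disposal the (cited, known) bound $x(t)^2+y(t)^2+z(t)^2\le K$ for all $t\in\mathbb{R}$, with $K=\frac{\beta^2(\rho+\sigma)^2}{4(\beta-1)}$ (which presupposes that this expression is defined). The number $\mu>0$ is the nudging parameter. Solutions of the discretely nudged system are continuous and satisfy the ODEs on each interval $[t_n,t_{n+1})$ (one-sided derivative at $t_n$).
   Formalization: The hypothesis μ > 1 (and β ≠ 1, so that K is defined) is added: the other hypotheses allow μ ≤ 1, e.g. σ=1/4, ρ=1/100, β=2, μ=δ=1/10 with zero solutions, and then γ ≥ 1; since β > 1 is forced, γ < 1 holds exactly when μ > 1. *)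

theory Defs
  imports "HOL-Analysis.Analysis"
begin

definition lorenz63_on ::
  "real \<Rightarrow> real \<Rightarrow> real \<Rightarrow> real set \<Rightarrow> (real \<Rightarrow> real) \<Rightarrow> (real \<Rightarrow> real) \<Rightarrow> (real \<Rightarrow> real) \<Rightarrow> bool"
  where
  "lorenz63_on \<sigma> \<rho> \<beta> I x y z \<longleftrightarrow>
    (\<forall>s\<in>I.
      (x has_real_derivative \<sigma> * (y s - x s)) (at s within I) \<and>
      (y has_real_derivative x s * (\<rho> - z s) - y s) (at s within I) \<and>
      (z has_real_derivative x s * y s - \<beta> * z s) (at s within I))"

text \<open>The image S(s)B of a set under the solution semigroup, written through forward solutions so
  that existence and uniqueness of the flow need not be built into the definition.\<close>

definition lorenz63_image ::
  "real \<Rightarrow> real \<Rightarrow> real \<Rightarrow> real \<Rightarrow> (real \<times> real \<times> real) set \<Rightarrow> (real \<times> real \<times> real) set"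
  where
  "lorenz63_image \<sigma> \<rho> \<beta> s B =
    {(x s, y s, z s) | x y z. lorenz63_on \<sigma> \<rho> \<beta> {0..} x y z \<and> (x 0, y 0, z 0) \<in> B}"

text \<open>The compact invariant set attracting all bounded sets. Nonemptiness is required explicitly
  because \<open>infdist p {} = 0\<close> would make the empty set attract everything.\<close>

definition lorenz63_global_attractor ::
  "real \<Rightarrow> real \<Rightarrow> real \<Rightarrow> (real \<times> real \<times> real) set \<Rightarrow> bool"
  where
  "lorenz63_global_attractor \<sigma> \<rho> \<beta> A \<longleftrightarrow>
    A \<noteq> {} \<and> compact A \<and>
    (\<forall>s\<ge>0. lorenz63_image \<sigma> \<rho> \<beta> s A = A) \<and>
    (\<forall>B. bounded B \<longrightarrow>
      (\<forall>\<epsilon>>0. \<exists>T\<ge>0. \<forall>s\<ge>T. \<forall>p\<in>lorenz63_image \<sigma> \<rho> \<beta> s B. infdist p A < \<epsilon>))"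

text \<open>Solutions \<open>(xb, yb, zb)\<close> on \<open>[0, \<infinity>)\<close> of the system nudged by the values of the reference
  component \<open>x\<close> at the observation times \<open>t 0 < t 1 < \<dots>\<close>. The derivative within
  \<open>{t n..<t (Suc n)}\<close> is the right derivative at \<open>t n\<close> and the ordinary one at interior points.\<close>

definition lorenz63_nudged ::
  "real \<Rightarrow> real \<Rightarrow> real \<Rightarrow> real \<Rightarrow> (nat \<Rightarrow> real) \<Rightarrow> (real \<Rightarrow> real) \<Rightarrow>
    (real \<Rightarrow> real) \<Rightarrow> (real \<Rightarrow> real) \<Rightarrow> (real \<Rightarrow> real) \<Rightarrow> bool"
  where
  "lorenz63_nudged \<sigma> \<rho> \<beta> \<mu> t x xb yb zb \<longleftrightarrow>
    continuous_on {0..} xb \<and> continuous_on {0..} yb \<and> continuous_on {0..} zb \<and>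
    (\<forall>n. \<forall>s\<in>{t n..<t (Suc n)}.
      (xb has_real_derivative \<sigma> * (yb s - xb s) - \<mu> * (xb (t n) - x (t n)))
        (at s within {t n..<t (Suc n)}) \<and>
      (yb has_real_derivative xb s * (\<rho> - zb s) - yb s) (at s within {t n..<t (Suc n)}) \<and>
      (zb has_real_derivative xb s * yb s - \<beta> * zb s) (at s within {t n..<t (Suc n)}))"

end

theory Submission
  imports Defs
begin

text \<open>The proof is an energy estimate for the error \<open>(u, v, w) = (x - xb, y - yb, z - zb)\<close>, whose
  squared length is \<open>V\<close>. In \<open>V'\<close> the cubic terms cancel, because the quadratic nonlinearity of
  Lorenz 63 conserves the squared length, and what remains is linear damping, the terms
  \<open>(\<rho> + \<sigma> - z) u v\<close> and \<open>y u w\<close> that couple the error to the reference solution, and the nudging term.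
  Only the first component of the error is nudged, but every dangerous term carries a factor \<open>u\<close>, so by
  Young's inequality and the bound \<open>K\<close> on the attractor a large \<open>\<mu>\<close> pays for all of
  them; this is \<open>error_energy_dissipation\<close>. The price of observing only at the times \<open>t n\<close> is the
  extra term \<open>2 \<mu> (u(s) - u(t n))\<^sup>2\<close>.

  On one step let \<open>M\<close> be the maximum of \<open>V\<close>. By the mean value theorem the extra term is of
  order \<open>\<mu> \<delta>\<^sup>2 (\<sigma> + \<mu>)\<^sup>2 M\<close>, and the smallness of \<open>\<delta>\<close> makes it at most \<open>M / 2\<close>, so that
  \<open>V' \<le> - c V + M / 2\<close>. Since \<open>c > 1 / 2\<close>, a solution of this inequality cannot rise above its
  initial value to reach a larger maximum \<open>M\<close>; hence \<open>M = V(t n)\<close>, and Gronwall's inequality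
  (\<open>exponential_comparison\<close>) turns \<open>V' \<le> - c V + V(t n) / 2\<close> into the factor \<open>\<gamma>\<close> over a step of length \<open>\<delta>\<close>
  (\<open>contraction_over_step\<close>). Induction over the steps concludes.\<close>

section \<open>Linear differential inequalities\<close>

lemma exponential_comparison:
  fixes V :: "real \<Rightarrow> real"
  assumes "a \<le> b" and "c > 0" and "continuous_on {a..b} V"
    and "\<And>s. \<lbrakk>a < s; s < b\<rbrakk> \<Longrightarrow> \<exists>D. (V has_real_derivative D) (at s) \<and> D \<le> - c * V s + \<theta>"
  shows "V b \<le> exp (- c * (b - a)) * V a + \<theta> / c * (1 - exp (- c * (b - a)))"
proof -
  \<comment> \<open>\<open>\<theta> / c\<close> is the equilibrium of \<open>V' = - c V + \<theta>\<close>; the rescaled distance to it cannot grow.\<close>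
  define f where "f = (\<lambda>s. (V s - \<theta> / c) * exp (c * (s - a)))"
  have "f b \<le> f a"
  proof (rule DERIV_nonpos_imp_decreasing_open [OF \<open>a \<le> b\<close>])
    fix s assume "a < s" "s < b"
    then obtain D where D: "(V has_real_derivative D) (at s)" "D \<le> - c * V s + \<theta>"
      using assms(4) by blast
    have "(f has_real_derivative (D + c * V s - \<theta>) * exp (c * (s - a))) (at s)"
      unfolding f_def using \<open>c > 0\<close>
      by (auto intro!: derivative_eq_intros D(1) simp: field_simps)
    moreover have "(D + c * V s - \<theta>) * exp (c * (s - a)) \<le> 0"
      using D(2) by (intro mult_nonpos_nonneg) auto
    ultimately show "\<exists>d. (f has_real_derivative d) (at s) \<and> d \<le> 0" by blast
  qed (auto simp: f_def intro!: continuous_intros assms(3))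
  then have "f b * exp (- c * (b - a)) \<le> f a * exp (- c * (b - a))"
    by (simp add: mult_right_mono)
  moreover have "f b * exp (- c * (b - a)) = V b - \<theta> / c"
    by (simp add: f_def exp_minus)
  ultimately show ?thesis
    by (simp add: f_def algebra_simps)
qed

text \<open>The assumption on \<open>V'\<close> involves a bound \<open>M\<close> of \<open>V\<close> on the whole step, because the
  right-hand side of the nudged system depends on the past of the step. Evaluating the comparison at a
  maximum point of \<open>V\<close> bounds the maximum by a convex combination of \<open>V a\<close> and
  \<open>M / (2 c)\<close>, where \<open>1 / (2 c) < 1\<close>; this forces \<open>M \<le> V a\<close>.\<close>

lemma contraction_over_step:
  fixes V :: "real \<Rightarrow> real"
  assumes "\<delta> > 0" and c: "c > 1 / 2" and cont: "continuous_on {a..a + \<delta>} V"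
    and nonneg: "\<And>s. V s \<ge> 0"
    and deriv: "\<And>M s. \<lbrakk>\<forall>r\<in>{a..a + \<delta>}. V r \<le> M; a < s; s < a + \<delta>\<rbrakk> \<Longrightarrow>
      \<exists>D. (V has_real_derivative D) (at s) \<and> D \<le> - c * V s + M / 2"
  shows "s \<in> {a..a + \<delta>} \<Longrightarrow> V s \<le> V a"
    and "V (a + \<delta>) \<le> 1 / (2 * c) * (1 + (2 * c - 1) * exp (- c * \<delta>)) * V a"
proof -
  have bound: "V r \<le> exp (- c * (r - a)) * V a + M / 2 / c * (1 - exp (- c * (r - a)))"
    if "\<forall>s\<in>{a..a + \<delta>}. V s \<le> M" "r \<in> {a..a + \<delta>}" for r M
  proof (rule exponential_comparison)
    show "continuous_on {a..r} V"
      using cont by (rule continuous_on_subset) (use that in auto)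
    show "\<exists>D. (V has_real_derivative D) (at s) \<and> D \<le> - c * V s + M / 2" if "a < s" "s < r" for s
      using deriv[OF \<open>\<forall>s\<in>{a..a + \<delta>}. V s \<le> M\<close>] that \<open>r \<in> {a..a + \<delta>}\<close> by auto
  qed (use that c in auto)
  obtain m where m: "m \<in> {a..a + \<delta>}" "\<forall>s\<in>{a..a + \<delta>}. V s \<le> V m"
    using continuous_attains_sup[OF _ _ cont] \<open>\<delta> > 0\<close> by auto
  have le_start: "V m \<le> V a"
  proof (rule ccontr)
    assume "\<not> V m \<le> V a"
    then have less: "V a < V m" by simp
    define e where "e = exp (- c * (m - a))"
    have e: "0 < e" "e \<le> 1" using m(1) c by (auto simp: e_def)
    have "V m / 2 / c \<le> V m"
      using mult_right_mono[of 1 "2 * c" "V m"] c nonneg[of m]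
      by (simp add: divide_le_eq mult.commute)
    then have "V m / 2 / c * (1 - e) \<le> V m * (1 - e)"
      using e by (intro mult_right_mono) auto
    moreover have "e * V a < e * V m" using e less by simp
    moreover have "V m \<le> e * V a + V m / 2 / c * (1 - e)"
      using bound[OF m(2) m(1)] by (simp add: e_def)
    ultimately show False by (simp add: algebra_simps)
  qed
  then have all: "\<forall>s\<in>{a..a + \<delta>}. V s \<le> V a" using m(2) by force
  then show "s \<in> {a..a + \<delta>} \<Longrightarrow> V s \<le> V a" by blast
  have "V (a + \<delta>) \<le> exp (- c * \<delta>) * V a + V a / 2 / c * (1 - exp (- c * \<delta>))"
    using bound[OF all, of "a + \<delta>"] \<open>\<delta> > 0\<close> by simp
  also have "\<dots> = 1 / (2 * c) * (1 + (2 * c - 1) * exp (- c * \<delta>)) * V a"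
    using c by (simp add: field_simps)
  finally show "V (a + \<delta>) \<le> 1 / (2 * c) * (1 + (2 * c - 1) * exp (- c * \<delta>)) * V a" .
qed

section \<open>The error system of Lorenz 63\<close>

text \<open>The left-hand side is the time derivative of \<open>u\<^sup>2 + v\<^sup>2 + w\<^sup>2\<close> for the error system, with
  \<open>u0\<close> the error at the last observation. The products \<open>x v w\<close> and \<open>u v w\<close> cancel; the remaining
  indefinite products all contain \<open>u\<close>, and Young's inequality absorbs them by spending half of the
  damping of \<open>v\<close> and of \<open>w\<close>. The coefficients of \<open>u\<^sup>2\<close> that this produces, less the damping
  \<open>2 \<sigma>\<close> that \<open>u\<close> has by itself, add up to the lower bound on \<open>\<mu>\<close>.\<close>

lemma error_energy_dissipation:
  fixes \<sigma> \<rho> \<beta> \<mu> K :: real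
  assumes "\<beta> > 0" and "\<mu> > 0" and K: "x\<^sup>2 + y\<^sup>2 + z\<^sup>2 \<le> K"
    and mu: "\<mu> \<ge> 2 * (\<rho> + \<sigma>)\<^sup>2 - 2 * \<sigma> + 2 * K + K / \<beta>"
  shows "2 * u * (\<sigma> * (v - u) - \<mu> * u0)
      + 2 * v * (\<rho> * u - v - (x * w + u * z - u * w))
      + 2 * w * (x * v + u * y - u * v - \<beta> * w)
    \<le> - (\<mu> / 2 * u\<^sup>2 + v\<^sup>2 + \<beta> * w\<^sup>2) + 2 * \<mu> * (u - u0)\<^sup>2"
proof -
  have y2: "y\<^sup>2 \<le> K" and z2: "z\<^sup>2 \<le> K"
    using K zero_le_power2[of x] zero_le_power2[of y] zero_le_power2[of z] by linarith+
  have uv: "2 * (\<rho> + \<sigma>) * u * v \<le> 2 * (\<rho> + \<sigma>)\<^sup>2 * u\<^sup>2 + v\<^sup>2 / 2"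
    using zero_le_power2[of "2 * (\<rho> + \<sigma>) * u - v"] by (simp add: power2_eq_square algebra_simps)
  have "- 2 * z * u * v \<le> 2 * z\<^sup>2 * u\<^sup>2 + v\<^sup>2 / 2"
    using zero_le_power2[of "2 * z * u + v"] by (simp add: power2_eq_square algebra_simps)
  also have "\<dots> \<le> 2 * K * u\<^sup>2 + v\<^sup>2 / 2"
    using mult_right_mono[OF z2, of "u\<^sup>2"] by simp
  finally have zuv: "- 2 * z * u * v \<le> 2 * K * u\<^sup>2 + v\<^sup>2 / 2" .
  have "0 \<le> (y * u - \<beta> * w)\<^sup>2 / \<beta>" using \<open>\<beta> > 0\<close> by simp
  also have "\<dots> = y\<^sup>2 * u\<^sup>2 / \<beta> + \<beta> * w\<^sup>2 - 2 * y * u * w"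
    using \<open>\<beta> > 0\<close> by (simp add: power2_eq_square field_simps)
  finally have "2 * y * u * w \<le> y\<^sup>2 * u\<^sup>2 / \<beta> + \<beta> * w\<^sup>2" by simp
  also have "\<dots> \<le> K / \<beta> * u\<^sup>2 + \<beta> * w\<^sup>2"
    using mult_right_mono[OF y2, of "u\<^sup>2"] \<open>\<beta> > 0\<close> by (simp add: divide_right_mono)
  finally have yuw: "2 * y * u * w \<le> K / \<beta> * u\<^sup>2 + \<beta> * w\<^sup>2" .
  have "0 \<le> \<mu> / 2 * (u - 2 * (u - u0))\<^sup>2" using \<open>\<mu> > 0\<close> by simp
  then have delay: "2 * \<mu> * u * (u - u0) \<le> \<mu> / 2 * u\<^sup>2 + 2 * \<mu> * (u - u0)\<^sup>2"
    by (simp add: power2_eq_square algebra_simps)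
  have nudge: "(2 * (\<rho> + \<sigma>)\<^sup>2 - 2 * \<sigma> + 2 * K + K / \<beta>) * u\<^sup>2 \<le> \<mu> * u\<^sup>2"
    using mu by (simp add: mult_right_mono)
  have "2 * u * (\<sigma> * (v - u) - \<mu> * u0)
      + 2 * v * (\<rho> * u - v - (x * w + u * z - u * w))
      + 2 * w * (x * v + u * y - u * v - \<beta> * w)
    = 2 * (\<rho> + \<sigma>) * u * v + - 2 * z * u * v + 2 * y * u * w + 2 * \<mu> * u * (u - u0)
      - 2 * \<sigma> * u\<^sup>2 - 2 * \<mu> * u\<^sup>2 - 2 * v\<^sup>2 - 2 * \<beta> * w\<^sup>2"
    by (simp add: power2_eq_square algebra_simps)
  also have "\<dots> \<le> - (\<mu> / 2 * u\<^sup>2 + v\<^sup>2 + \<beta> * w\<^sup>2) + 2 * \<mu> * (u - u0)\<^sup>2"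
    using uv zuv yuw delay nudge by (simp add: distrib_right left_diff_distrib)
  finally show ?thesis .
qed

text \<open>The energy inequality needs \<open>u\<close> at the present time, while the nudging only sees
  \<open>u a\<close>. Since \<open>u'\<close> is linear in the error, \<open>u\<close> moves by at most
  \<open>2 \<delta> (\<sigma> + \<mu>) sqrt M\<close> during a step.\<close>

lemma nudging_delay_bound:
  fixes u v :: "real \<Rightarrow> real"
  assumes "\<sigma> > 0" and "\<mu> > 0" and "\<delta> > 0"
    and d: "\<delta> \<le> 1 / (2 * \<mu>)" "\<delta> \<le> 1 / (64 * (\<sigma> + \<mu>)\<^sup>2)"
    and s: "a < s" "s < a + \<delta>"
    and cont: "continuous_on {a..s} u"
    and deriv: "\<And>r. \<lbrakk>a < r; r < a + \<delta>\<rbrakk> \<Longrightarrow>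
      (u has_real_derivative \<sigma> * (v r - u r) - \<mu> * u a) (at r)"
    and M: "\<forall>r\<in>{a..a + \<delta>}. (u r)\<^sup>2 \<le> M \<and> (v r)\<^sup>2 \<le> M"
  shows "2 * \<mu> * (u s - u a)\<^sup>2 \<le> M / 2"
proof -
  have "\<exists>l r. a < r \<and> r < s \<and> DERIV u r :> l \<and> u s - u a = (s - a) * l"
  proof (intro MVT cont)
    show "u differentiable (at r)" if "a < r" "r < s" for r
      using deriv[of r] s that by (auto simp: real_differentiable_def)
  qed (rule s)
  then obtain l r where r: "a < r" "r < s" and l: "DERIV u r :> l" and eq: "u s - u a = (s - a) * l"
    by blast
  have l_eq: "l = \<sigma> * (v r - u r) - \<mu> * u a"
    using DERIV_unique[OF l deriv] r s by auto
  have abs_le: "\<bar>u r\<bar> \<le> sqrt M" "\<bar>v r\<bar> \<le> sqrt M" "\<bar>u a\<bar> \<le> sqrt M"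
    using M r s \<open>\<delta> > 0\<close> by (auto intro!: real_le_rsqrt)
  have "M \<ge> 0" using abs_le(1) order_trans[OF abs_ge_zero] by fastforce
  have "\<bar>l\<bar> \<le> \<sigma> * \<bar>v r - u r\<bar> + \<mu> * \<bar>u a\<bar>"
    unfolding l_eq using abs_triangle_ineq4[of "\<sigma> * (v r - u r)" "\<mu> * u a"] \<open>\<sigma> > 0\<close> \<open>\<mu> > 0\<close>
    by (simp add: abs_mult)
  also have "\<dots> \<le> \<sigma> * (2 * sqrt M) + \<mu> * (2 * sqrt M)"
    using abs_le \<open>\<sigma> > 0\<close> \<open>\<mu> > 0\<close> by (intro add_mono mult_left_mono) auto
  finally have l_le: "\<bar>l\<bar> \<le> 2 * (\<sigma> + \<mu>) * sqrt M" by (simp add: algebra_simps)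
  have "\<bar>u s - u a\<bar> \<le> \<delta> * (2 * (\<sigma> + \<mu>) * sqrt M)"
    unfolding eq abs_mult using s l_le by (intro mult_mono) auto
  then have "(u s - u a)\<^sup>2 \<le> (\<delta> * (2 * (\<sigma> + \<mu>) * sqrt M))\<^sup>2"
    by (metis abs_ge_zero power2_abs power_mono)
  also have "\<dots> = \<delta> * (\<delta> * (4 * (\<sigma> + \<mu>)\<^sup>2)) * (sqrt M)\<^sup>2"
    by algebra
  also have "\<dots> = \<delta> * (\<delta> * (4 * (\<sigma> + \<mu>)\<^sup>2)) * M"
    using \<open>M \<ge> 0\<close> by simp
  also have "\<dots> \<le> 1 / (2 * \<mu>) * (1 / 16) * M"
  proof (intro mult_right_mono mult_mono)
    have "\<delta> * (4 * (\<sigma> + \<mu>)\<^sup>2) \<le> 1 / (64 * (\<sigma> + \<mu>)\<^sup>2) * (4 * (\<sigma> + \<mu>)\<^sup>2)"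
      using d(2) by (intro mult_right_mono) auto
    then show "\<delta> * (4 * (\<sigma> + \<mu>)\<^sup>2) \<le> 1 / 16"
      using \<open>\<sigma> > 0\<close> \<open>\<mu> > 0\<close> by (simp add: field_simps)
  qed (use d \<open>M \<ge> 0\<close> \<open>\<mu> > 0\<close> \<open>\<delta> > 0\<close> in auto)
  finally have "2 * \<mu> * (u s - u a)\<^sup>2 \<le> 2 * \<mu> * (1 / (2 * \<mu>) * (1 / 16) * M)"
    using \<open>\<mu> > 0\<close> by (intro mult_left_mono) auto
  also have "\<dots> \<le> M / 2" using \<open>\<mu> > 0\<close> \<open>M \<ge> 0\<close> by simp
  finally show ?thesis .
qed

section \<open>Convergence under discrete observations\<close>

theorem theorem4p3:
  fixes \<sigma> \<rho> \<beta> \<mu> \<delta> K c \<gamma> :: real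
    and x y z xb yb zb V :: "real \<Rightarrow> real"
    and t :: "nat \<Rightarrow> real"
    and A :: "(real \<times> real \<times> real) set"
  assumes "\<sigma> > 0" and "\<rho> > 0" and "\<beta> > 0" and "\<beta> \<noteq> 1"
    and "K = \<beta>\<^sup>2 * (\<rho> + \<sigma>)\<^sup>2 / (4 * (\<beta> - 1))"
    and "lorenz63_on \<sigma> \<rho> \<beta> UNIV x y z"
    and "lorenz63_global_attractor \<sigma> \<rho> \<beta> A"
    and "\<forall>s. (x s, y s, z s) \<in> A"
    and "\<forall>s. (x s)\<^sup>2 + (y s)\<^sup>2 + (z s)\<^sup>2 \<le> K"
    and "\<delta> > 0" and "t 0 = 0" and "\<forall>n. t (Suc n) - t n = \<delta>"
    and "\<mu> > 0"
    and "lorenz63_nudged \<sigma> \<rho> \<beta> \<mu> t x xb yb zb"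
    and "\<forall>s. V s = (x s - xb s)\<^sup>2 + (y s - yb s)\<^sup>2 + (z s - zb s)\<^sup>2"
    and "\<mu> \<ge> 2 * (\<rho> + \<sigma>)\<^sup>2 - 2 * \<sigma> + 2 * K + K / \<beta>"
    and "\<delta> \<le> Min {1 / (2 * \<mu>), 1 / (64 * (\<sigma> + \<mu>)\<^sup>2), 1 / (32 * \<mu> * \<sigma>\<^sup>2)}"
    and "c = Min {\<mu> / 2, 1, \<beta>}"
    and "\<gamma> = 1 / (2 * c) * (1 + (2 * c - 1) * exp (- c * \<delta>))"
    and "\<mu> > 1"
  shows "\<gamma> < 1 \<and> (\<forall>n. \<forall>s\<in>{t n..<t (Suc n)}. V s \<le> \<gamma> ^ n * V 0)"
proof -
  \<comment> \<open>For \<open>\<beta> < 1\<close> the number \<open>K\<close> is negative and cannot bound a sum of squares.\<close>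
  have "\<beta> > 1"
  proof (rule ccontr)
    assume "\<not> \<beta> > 1"
    with assms(4) have "\<beta> - 1 < 0" by simp
    then have "K < 0"
      using assms(1-3) unfolding assms(5) by (intro divide_pos_neg) auto
    moreover have "0 \<le> K"
      using spec[OF assms(9), of 0] zero_le_power2[of "x 0"] zero_le_power2[of "y 0"]
        zero_le_power2[of "z 0"] by linarith
    ultimately show False by simp
  qed
  have c: "c > 1 / 2" "c \<le> \<mu> / 2" "c \<le> 1" "c \<le> \<beta>"
    using assms(18) \<open>\<beta> > 1\<close> \<open>\<mu> > 1\<close> by auto
  have d: "\<delta> \<le> 1 / (2 * \<mu>)" "\<delta> \<le> 1 / (64 * (\<sigma> + \<mu>)\<^sup>2)"
    using assms(17) by auto
  have V_eq: "V = (\<lambda>s. (x s - xb s)\<^sup>2 + (y s - yb s)\<^sup>2 + (z s - zb s)\<^sup>2)"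
    using assms(15) by auto
  have V_nonneg: "V s \<ge> 0" for s by (simp add: V_eq)
  have ref: "(x has_real_derivative \<sigma> * (y s - x s)) (at s)"
    "(y has_real_derivative x s * (\<rho> - z s) - y s) (at s)"
    "(z has_real_derivative x s * y s - \<beta> * z s) (at s)" for s
    using assms(6) by (auto simp: lorenz63_on_def)
  have t_Suc: "t (Suc n) = t n + \<delta>" for n
    using assms(12) by (metis add.commute diff_add_cancel)
  have t_nonneg: "t n \<ge> 0" for n
    using assms(10,11) by (induction n) (auto simp: t_Suc)
  have ref_cont: "continuous_on {0..} x" "continuous_on {0..} y" "continuous_on {0..} z"
    by (rule DERIV_continuous_on[OF has_field_derivative_at_within], rule ref)+
  have xb_cont: "continuous_on {0..} xb" "continuous_on {0..} yb" "continuous_on {0..} zb"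
    using assms(14) unfolding lorenz63_nudged_def by blast+
  have cont: "continuous_on {0..} (\<lambda>s. x s - xb s)" "continuous_on {0..} V"
    unfolding V_eq
    by (intro continuous_intros ref_cont xb_cont)+
  have nudged: "(xb has_real_derivative \<sigma> * (yb s - xb s) - \<mu> * (xb (t n) - x (t n))) (at s)"
    "(yb has_real_derivative xb s * (\<rho> - zb s) - yb s) (at s)"
    "(zb has_real_derivative xb s * yb s - \<beta> * zb s) (at s)"
    if "t n < s" "s < t n + \<delta>" for n s
  proof -
    have within: "at s within {t n..<t (Suc n)} = at s"
      using that by (intro at_within_interior) (auto simp: t_Suc)
    have "s \<in> {t n..<t (Suc n)}" using that by (simp add: t_Suc)
    with assms(14) have "(xb has_real_derivative \<sigma> * (yb s - xb s) - \<mu> * (xb (t n) - x (t n)))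
        (at s within {t n..<t (Suc n)}) \<and>
      (yb has_real_derivative xb s * (\<rho> - zb s) - yb s) (at s within {t n..<t (Suc n)}) \<and>
      (zb has_real_derivative xb s * yb s - \<beta> * zb s) (at s within {t n..<t (Suc n)})"
      unfolding lorenz63_nudged_def by blast
    then show "(xb has_real_derivative \<sigma> * (yb s - xb s) - \<mu> * (xb (t n) - x (t n))) (at s)"
      "(yb has_real_derivative xb s * (\<rho> - zb s) - yb s) (at s)"
      "(zb has_real_derivative xb s * yb s - \<beta> * zb s) (at s)"
      unfolding within by blast+
  qed
  have u_deriv: "((\<lambda>s. x s - xb s) has_real_derivative
      \<sigma> * ((y s - yb s) - (x s - xb s)) - \<mu> * (x (t n) - xb (t n))) (at s)"
    if "t n < s" "s < t n + \<delta>" for n s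
    using DERIV_diff[OF ref(1) nudged(1)[OF that]] by (simp add: algebra_simps)
  have V_deriv: "\<exists>D. (V has_real_derivative D) (at s) \<and> D \<le> - c * V s + M / 2"
    if M: "\<forall>r\<in>{t n..t n + \<delta>}. V r \<le> M" and s: "t n < s" "s < t n + \<delta>" for n M s
  proof -
    define u v w u0 where "u = x s - xb s" "v = y s - yb s" "w = z s - zb s"
      "u0 = x (t n) - xb (t n)"
    note uvw = this
    have comp_le: "(x r - xb r)\<^sup>2 \<le> V r" "(y r - yb r)\<^sup>2 \<le> V r" for r
      by (auto simp: V_eq)
    have delay: "2 * \<mu> * (u - u0)\<^sup>2 \<le> M / 2"
      unfolding uvw
    proof (rule nudging_delay_bound[where v = "\<lambda>s. y s - yb s" and u = "\<lambda>s. x s - xb s"])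
      show "continuous_on {t n..s} (\<lambda>s. x s - xb s)"
        using cont(1) by (rule continuous_on_subset) (use t_nonneg[of n] in auto)
      show "\<forall>r\<in>{t n..t n + \<delta>}. (x r - xb r)\<^sup>2 \<le> M \<and> (y r - yb r)\<^sup>2 \<le> M"
        using M comp_le order_trans by blast
    qed (use assms(1,10,13) s d u_deriv in simp_all)
    let ?D = "2 * u * (\<sigma> * (v - u) - \<mu> * u0)
      + 2 * v * (\<rho> * u - v - (x s * w + u * z s - u * w))
      + 2 * w * (x s * v + u * y s - u * v - \<beta> * w)"
    have "(V has_real_derivative ?D) (at s)"
      unfolding V_eq uvw
      by (rule derivative_eq_intros ref nudged[OF s] refl)+ (simp add: algebra_simps)
    moreover have "?D \<le> - c * V s + M / 2"
    proof -
      have "?D \<le> - (\<mu> / 2 * u\<^sup>2 + v\<^sup>2 + \<beta> * w\<^sup>2) + 2 * \<mu> * (u - u0)\<^sup>2"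
        using assms(3,9,13,16) by (intro error_energy_dissipation) auto
      also have "\<dots> \<le> - (c * u\<^sup>2 + 1 * v\<^sup>2 + \<beta> * w\<^sup>2) + M / 2"
        using mult_right_mono[OF c(2), of "u\<^sup>2"] delay by simp
      also have "\<dots> \<le> - (c * u\<^sup>2 + c * v\<^sup>2 + c * w\<^sup>2) + M / 2"
        using mult_right_mono[OF c(3), of "v\<^sup>2"] mult_right_mono[OF c(4), of "w\<^sup>2"] by simp
      also have "\<dots> = - c * V s + M / 2"
        by (simp add: V_eq uvw algebra_simps)
      finally show ?thesis .
    qed
    ultimately show ?thesis by blast
  qed
  have cont_step: "continuous_on {t n..t n + \<delta>} V" for n
    using cont(2) by (rule continuous_on_subset) (use t_nonneg[of n] in auto)
  have V_step: "V s \<le> V (t n)" if "s \<in> {t n..t n + \<delta>}" for n s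
    using \<open>\<delta> > 0\<close> c(1) cont_step V_nonneg V_deriv that by (rule contraction_over_step(1))
  have V_Suc: "V (t n + \<delta>) \<le> \<gamma> * V (t n)" for n
    unfolding assms(19) using \<open>\<delta> > 0\<close> c(1) cont_step V_nonneg V_deriv
    by (rule contraction_over_step(2))
  have \<gamma>_alt: "\<gamma> = (1 - exp (- c * \<delta>)) / (2 * c) + exp (- c * \<delta>)"
    unfolding assms(19) using c(1) by (simp add: field_simps)
  have e: "exp (- c * \<delta>) < 1" using c(1) \<open>\<delta> > 0\<close> by simp
  have "\<gamma> \<ge> 0" unfolding \<gamma>_alt using e c(1) by simp
  have "(1 - exp (- c * \<delta>)) / (2 * c) < 1 - exp (- c * \<delta>)"
    using e c(1) by (simp add: divide_less_eq)
  then have "\<gamma> < 1" unfolding \<gamma>_alt by simp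
  have V_t: "V (t n) \<le> \<gamma> ^ n * V 0" for n
  proof (induction n)
    case 0
    show ?case using assms(11) by simp
  next
    case (Suc n)
    have "V (t (Suc n)) \<le> \<gamma> * V (t n)"
      using V_Suc[of n] unfolding t_Suc .
    also have "\<dots> \<le> \<gamma> * (\<gamma> ^ n * V 0)" using Suc \<open>\<gamma> \<ge> 0\<close> by (rule mult_left_mono)
    finally show ?case by (simp add: mult.assoc)
  qed
  have "V s \<le> \<gamma> ^ n * V 0" if "s \<in> {t n..<t (Suc n)}" for n s
    using V_step[of s n] V_t[of n] that by (simp add: t_Suc)
  with \<open>\<gamma> < 1\<close> show ?thesis by blast
qed

end
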